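(* Let $\mathcal G=(V,E)$ be a constraint graph over $(\mathbb F,S)$ with $V$ countable, and $X=X_{\mathcal G}\subset V^{\mathbb F}$ its graph subshift. Suppose there are a finite set $A\subset V$ and a shift-invariant Borel probability measure $\mu$ on $X$ such that for $\mu$-almost every $x\in X$, every $S$-connected component of the set $x^{-1}(V\setminus A)\subset\mathbb F$ is finite. Then there exists a periodic treequence in $X$. Moreover, if $\mu(\{x\in X: x(\mathrm{id})=a_1\})>0$ for some $a_1\in A$, then there exists a periodic treequence $x\in X$ with $x(\mathrm{id})=a_1$.
   Context: $\mathbb F$ is a finitely generated free group with symmetric free generating set $S=B\cup B^{-1}$, $B$ a free basis. A constraint graph is $\mathcal G=(V,E)$ with $E\subset V\times V\times S$. $X_{\mathcal G}$ is the set of $x:\mathbb F\to V$ with $(x(f),x(fs);s)\in E$ for all $f\in\mathbb F$, $s\in S$, with the product topology; shifts $(\sigma_gx)(f)=x(g^{-1}f)$; $x$ is periodic if its stabilizer $\{f:\sigma_fx=x\}$ has finite index. The Cayley graph of $\mathbb F$ has vertex set $\mathbb F$ and an edge from $f$ to $fs$ for each $f\in\mathbb F$, $s\in S$. A subset $D\subset\mathbb F$ is $S$-connected if its induced subgraph in the Cayley graph is connected; an $S$-connected component of $F_0\subset\mathbb F$ is a maximal $S$-connected subset of $F_0$. *)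

theory Defs
  imports "HOL-Probability.Probability"
begin

text \<open>A letter (b, True) stands for the basis element b, (b, False) for its inverse.
  The symmetric generating set S is the set of all letters.\<close>

type_synonym 'b letter = "'b \<times> bool"

fun inv_letter :: "'b letter \<Rightarrow> 'b letter" where
  "inv_letter (b, e) = (b, \<not> e)"

definition reduced :: "'b letter list \<Rightarrow> bool" where
  "reduced w \<longleftrightarrow> (\<forall>i. Suc i < length w \<longrightarrow> w ! Suc i \<noteq> inv_letter (w ! i))"

typedef 'b fgrp = "{w :: 'b letter list. reduced w}"
  by (rule exI[of _ "[]"]) (simp add: reduced_def)

definition app_letter :: "'b letter list \<Rightarrow> 'b letter \<Rightarrow> 'b letter list" where
  "app_letter w s = (if w \<noteq> [] \<and> last w = inv_letter s then butlast w else w @ [s])"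

definition mult_words :: "'b letter list \<Rightarrow> 'b letter list \<Rightarrow> 'b letter list" where
  "mult_words u v = foldl app_letter u v"

definition fmult :: "'b fgrp \<Rightarrow> 'b fgrp \<Rightarrow> 'b fgrp" where
  "fmult f g = Abs_fgrp (mult_words (Rep_fgrp f) (Rep_fgrp g))"

definition finv :: "'b fgrp \<Rightarrow> 'b fgrp" where
  "finv f = Abs_fgrp (rev (map inv_letter (Rep_fgrp f)))"

definition fid :: "'b fgrp" where
  "fid = Abs_fgrp []"

definition gen :: "'b letter \<Rightarrow> 'b fgrp" where
  "gen s = Abs_fgrp [s]"

text \<open>Constraint graph: vertex set V = UNIV of a countable type 'v, edge set
  E \<subseteq> V \<times> V \<times> S.\<close>

definition XG :: "('v \<times> 'v \<times> 'b letter) set \<Rightarrow> ('b fgrp \<Rightarrow> 'v) set" where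
  "XG E = {x. \<forall>f s. (x f, x (fmult f (gen s)), s) \<in> E}"

definition shift :: "'b fgrp \<Rightarrow> ('b fgrp \<Rightarrow> 'v) \<Rightarrow> ('b fgrp \<Rightarrow> 'v)" where
  "shift g x = (\<lambda>f. x (fmult (finv g) f))"

definition stabilizer :: "('b fgrp \<Rightarrow> 'v) \<Rightarrow> 'b fgrp set" where
  "stabilizer x = {f. shift f x = x}"

definition periodic :: "('b fgrp \<Rightarrow> 'v) \<Rightarrow> bool" where
  "periodic x \<longleftrightarrow> finite {(\<lambda>h. fmult f h) ` stabilizer x | f. True}"

text \<open>Product sigma-algebra on V^F (V discrete countable, F countable, so this is
  the Borel sigma-algebra of the product topology).\<close>
definition config_space :: "('b fgrp \<Rightarrow> 'v) measure" where
  "config_space = PiM UNIV (\<lambda>_. count_space UNIV)"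

definition S_connected :: "'b fgrp set \<Rightarrow> bool" where
  "S_connected D \<longleftrightarrow> (\<forall>u\<in>D. \<forall>v\<in>D. \<exists>p :: 'b fgrp list.
      p \<noteq> [] \<and> hd p = u \<and> last p = v \<and> set p \<subseteq> D \<and>
      (\<forall>i. Suc i < length p \<longrightarrow> (\<exists>s. p ! Suc i = fmult (p ! i) (gen s))))"

definition S_component :: "'b fgrp set \<Rightarrow> 'b fgrp set \<Rightarrow> bool" where
  "S_component F0 C \<longleftrightarrow> C \<subseteq> F0 \<and> S_connected C \<and>
      (\<forall>D. C \<subseteq> D \<and> D \<subseteq> F0 \<and> S_connected D \<longrightarrow> D = C)"

end

theory Submission
  imports Defs
begin

text \<open>
  Cut the Cayley tree of a typical configuration at all vertices with colour in \<open>A\<close>; the remaining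
  blocks are finite. Finitely many blocks glue to a finite permutation model, hence to a periodic
  point, as soon as for each colour \<open>a \<in> A\<close> the number of half-edges with colour \<open>a\<close> and label \<open>s\<close>
  does not depend on \<open>s\<close>. These are finitely many homogeneous linear equations. If a linear
  combination of them is nonnegative on all blocks that occur, then the mass transport principle
  shows that its mean vanishes, so it is zero on all of them. By Stiemke's alternative every
  occurring block therefore belongs to a finite balanced family.
\<close>

section \<open>The free group\<close>

text \<open>The constraint \<open>E\<close> looks only at single edges, so the gluing need not
  remember which half-edges shared a vertex: any choice of bijections between the half-edges of one
  colour with label \<open>s0\<close> and those of the same colour with label \<open>s\<close> gives
  a legal model. Only counts matter. At a vertex with colour outside \<open>A\<close> a block
  contains all half-edges or none, so there the counts balance by themselves; hence finitely many
  equations, although \<open>V\<close> may be infinite. The mean vanishes because a combination of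
  the equations is a sum of half-edge weights whose total at every single vertex is zero; when each
  half-edge shares its weight evenly among its block, that zero becomes the mean of block averages.
  The obstacle is that this yields only almost sure statements, with a null set depending on the
  combination, and there are uncountably many combinations. A finite block is fixed by a cylinder,
  and cylinders are countably many, so one null set discarded in advance serves them all.
  Multiplicities in a balanced family are natural numbers, which is why the alternative is stated
  for integer vectors.\<close>

lemma inv_letter_inv_letter [simp]: "inv_letter (inv_letter s) = s"
  by (cases s) simp

lemma reduced_Nil [simp]: "reduced []"
  by (simp add: reduced_def)

lemma reduced_single [simp]: "reduced [s]"
  by (simp add: reduced_def)

lemma reduced_snoc:
  "reduced (w @ [s]) \<longleftrightarrow> reduced w \<and> (w = [] \<or> last w \<noteq> inv_letter s)"
proof (cases w rule: rev_cases)
  case Nil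
  then show ?thesis by (simp add: reduced_def)
next
  case (snoc v t)
  have "reduced (w @ [s]) \<longleftrightarrow> reduced w \<and> s \<noteq> inv_letter t"
  proof
    assume r: "reduced (w @ [s])"
    have "reduced w"
      unfolding reduced_def
    proof (intro allI impI)
      fix i assume i: "Suc i < length w"
      then have "(w @ [s]) ! Suc i \<noteq> inv_letter ((w @ [s]) ! i)"
        using r by (simp add: reduced_def)
      with i show "w ! Suc i \<noteq> inv_letter (w ! i)"
        by (simp add: nth_append)
    qed
    moreover have "(w @ [s]) ! Suc (length v) \<noteq> inv_letter ((w @ [s]) ! length v)"
      using r[unfolded reduced_def, rule_format, of "length v"] snoc by fastforce
    ultimately show "reduced w \<and> s \<noteq> inv_letter t"
      using snoc by (simp add: nth_append)
  next
    assume r: "reduced w \<and> s \<noteq> inv_letter t"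
    show "reduced (w @ [s])"
      unfolding reduced_def
    proof (intro allI impI)
      fix i assume i: "Suc i < length (w @ [s])"
      show "(w @ [s]) ! Suc i \<noteq> inv_letter ((w @ [s]) ! i)"
      proof (cases "Suc i < length w")
        case True
        then show ?thesis using r by (simp add: reduced_def nth_append)
      next
        case False
        then have "i = length v" using i snoc by simp
        then show ?thesis using r snoc by (simp add: nth_append)
      qed
    qed
  qed
  moreover have "s \<noteq> inv_letter t \<longleftrightarrow> t \<noteq> inv_letter s"
    by (metis inv_letter_inv_letter)
  ultimately show ?thesis using snoc by simp
qed

lemma reduced_app_letter: "reduced w \<Longrightarrow> reduced (app_letter w s)"
  by (cases w rule: rev_cases)
    (auto simp: app_letter_def reduced_snoc simp flip: append_assoc simp del: append_assoc)

lemma app_letter_inv: "reduced w \<Longrightarrow> app_letter (app_letter w s) (inv_letter s) = w"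
  by (cases w rule: rev_cases) (auto simp: app_letter_def reduced_snoc butlast_append)

lemma mult_words_Nil [simp]: "mult_words u [] = u"
  by (simp add: mult_words_def)

lemma mult_words_snoc [simp]: "mult_words u (v @ [s]) = app_letter (mult_words u v) s"
  by (simp add: mult_words_def)

lemma mult_words_Cons: "mult_words u (s # v) = mult_words (app_letter u s) v"
  by (simp add: mult_words_def)

lemma reduced_mult_words: "reduced u \<Longrightarrow> reduced (mult_words u v)"
  by (induction v rule: rev_induct) (auto intro: reduced_app_letter)

text \<open>Associativity for a single letter. If \<open>s\<close> cancels the end of
  \<open>v\<close>, the left side stops one letter earlier, while the right side applies that letter
  and undoes it; the undoing needs a reduced word.\<close>

lemma mult_words_app_letter:
  assumes "reduced u"
  shows "mult_words u (app_letter v s) = app_letter (mult_words u v) s"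
proof (cases "v \<noteq> [] \<and> last v = inv_letter s")
  case True
  then obtain v' where "v = v' @ [inv_letter s]"
    by (metis append_butlast_last_id)
  then show ?thesis
    using app_letter_inv[OF reduced_mult_words[OF assms, of v'], of "inv_letter s"]
    by (simp add: app_letter_def[of "v' @ _"])
qed (auto simp: app_letter_def[of v])

lemma mult_words_assoc:
  "reduced u \<Longrightarrow> mult_words (mult_words u v) w = mult_words u (mult_words v w)"
  by (induction w rule: rev_induct) (auto simp: mult_words_app_letter)

lemma Nil_mult_words: "reduced w \<Longrightarrow> mult_words [] w = w"
  by (induction w rule: rev_induct) (auto simp: reduced_snoc app_letter_def)

lemma rev_inv_mult_words: "mult_words (rev (map inv_letter w)) w = []"
  by (induction w) (auto simp: mult_words_Cons app_letter_def)

lemma reduced_rev_inv: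
  assumes "reduced w"
  shows "reduced (rev (map inv_letter w))"
  unfolding reduced_def
proof (intro allI impI)
  fix i assume i: "Suc i < length (rev (map inv_letter w))"
  define j where "j = length w - Suc (Suc i)"
  have j: "Suc j < length w" "length w - Suc i = Suc j"
    using i by (auto simp: j_def)
  have "w ! Suc j \<noteq> inv_letter (w ! j)"
    using assms j(1) unfolding reduced_def by blast
  then show "rev (map inv_letter w) ! Suc i \<noteq> inv_letter (rev (map inv_letter w) ! i)"
    using i j by (auto simp: rev_nth j_def)
qed

lemma reduced_Rep_fgrp [simp]: "reduced (Rep_fgrp f)"
  using Rep_fgrp by auto

lemma Rep_Abs_fgrp: "reduced w \<Longrightarrow> Rep_fgrp (Abs_fgrp w) = w"
  by (simp add: Abs_fgrp_inverse)

lemma Rep_fmult: "Rep_fgrp (fmult f g) = mult_words (Rep_fgrp f) (Rep_fgrp g)"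
  by (simp add: fmult_def Rep_Abs_fgrp reduced_mult_words)

lemma Rep_fid [simp]: "Rep_fgrp fid = []"
  by (simp add: fid_def Rep_Abs_fgrp)

lemma Rep_finv: "Rep_fgrp (finv f) = rev (map inv_letter (Rep_fgrp f))"
  by (simp add: finv_def Rep_Abs_fgrp reduced_rev_inv)

lemma Rep_gen: "Rep_fgrp (gen s) = [s]"
  by (simp add: gen_def Rep_Abs_fgrp reduced_def)

lemma fgrp_eqI: "Rep_fgrp f = Rep_fgrp g \<Longrightarrow> f = g"
  by (simp add: Rep_fgrp_inject)

lemma Rep_fmult_gen: "Rep_fgrp (fmult f (gen s)) = app_letter (Rep_fgrp f) s"
  by (simp add: Rep_fmult Rep_gen mult_words_def)

lemma fmult_assoc: "fmult (fmult f g) h = fmult f (fmult g h)"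
  by (rule fgrp_eqI) (simp add: Rep_fmult mult_words_assoc)

lemma fmult_fid [simp]: "fmult f fid = f" "fmult fid f = f"
  by (rule fgrp_eqI; simp add: Rep_fmult Nil_mult_words)+

lemma finv_fmult [simp]: "fmult (finv f) f = fid"
  by (rule fgrp_eqI) (simp add: Rep_fmult Rep_finv rev_inv_mult_words)

lemma finv_finv [simp]: "finv (finv f) = f"
  by (rule fgrp_eqI) (simp add: Rep_finv rev_map o_def)

lemma fmult_finv [simp]: "fmult f (finv f) = fid"
  using finv_fmult[of "finv f"] by simp

lemma finv_fmult_cancel [simp]: "fmult (finv f) (fmult f g) = g"
  by (simp flip: fmult_assoc)

lemma fmult_finv_cancel [simp]: "fmult f (fmult (finv f) g) = g"
  by (simp flip: fmult_assoc)

lemma finv_fid [simp]: "finv fid = fid"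
  by (rule fgrp_eqI) (simp add: Rep_finv)

lemma finv_of_fmult: "finv (fmult f g) = fmult (finv g) (finv f)"
proof -
  have "fmult (finv (fmult f g)) (fmult (fmult f g) (fmult (finv g) (finv f)))
      = fmult (finv (fmult f g)) fid"
    by (simp add: fmult_assoc)
  then show ?thesis by simp
qed

lemma fmult_gen_cancel [simp]: "fmult (fmult f (gen s)) (gen (inv_letter s)) = f"
  by (rule fgrp_eqI) (simp add: Rep_fmult_gen app_letter_inv)

lemma shift_shift: "shift f (shift g x) = shift (fmult f g) x"
  by (simp add: shift_def finv_of_fmult fmult_assoc)

lemma shift_fid [simp]: "shift fid x = x"
  by (simp add: shift_def)

lemma shift_in_XG: "x \<in> XG E \<Longrightarrow> shift g x \<in> XG E"
  by (auto simp: XG_def shift_def simp flip: fmult_assoc)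

instance fgrp :: (countable) countable
proof (rule countable_classI[of "to_nat \<circ> Rep_fgrp"])
  fix f g :: "'a fgrp"
  assume "(to_nat \<circ> Rep_fgrp) f = (to_nat \<circ> Rep_fgrp) g"
  then show "f = g" by (simp add: Rep_fgrp_inject)
qed

section \<open>Periodic points from finite permutation models\<close>

text \<open>Orbit-stabilizer correspondence: left cosets are the fibres of the orbit map, so a
  finite orbit leaves finitely many cosets.\<close>

lemma coset_stabilizer:
  "(\<lambda>h. fmult f h) ` stabilizer x = {k. shift k x = shift f x}"
proof (intro set_eqI iffI)
  fix k assume "k \<in> {k. shift k x = shift f x}"
  then have "shift (finv f) (shift k x) = shift (finv f) (shift f x)" by simp
  then have "fmult (finv f) k \<in> stabilizer x"
    by (simp add: shift_shift stabilizer_def)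
  then show "k \<in> (\<lambda>h. fmult f h) ` stabilizer x"
    by (rule rev_image_eqI) simp
qed (auto simp: stabilizer_def simp flip: shift_shift)

lemma periodic_if_finite_orbit:
  assumes "finite (range (\<lambda>f. shift f x))"
  shows "periodic x"
proof -
  have "{(\<lambda>h. fmult f h) ` stabilizer x | f. True}
      = (\<lambda>z. {k. shift k x = z}) ` range (\<lambda>f. shift f x)"
    by (auto simp: coset_stabilizer)
  then show ?thesis using assms by (simp add: periodic_def)
qed

text \<open>The maps \<open>\<pi> s\<close> form a Schreier graph on \<open>P\<close>: since
  \<open>\<pi> (inv_letter s)\<close> undoes \<open>\<pi> s\<close>, following a word respects
  cancellation and gives a right action of the free group. Colours read along the orbit of
  \<open>p0\<close> give \<open>x\<close>. A shift only moves the base point, so \<open>x\<close>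
  has at most \<open>card P\<close> translates.\<close>

lemma periodic_from_permutations:
  fixes E :: "('v \<times> 'v \<times> 'b letter) set" and \<pi> :: "'b letter \<Rightarrow> 'p \<Rightarrow> 'p"
  assumes "finite P" and p0: "p0 \<in> P"
    and \<pi>: "\<And>s p. p \<in> P \<Longrightarrow> \<pi> s p \<in> P" "\<And>s p. p \<in> P \<Longrightarrow> \<pi> (inv_letter s) (\<pi> s p) = p"
    and E: "\<And>s p. p \<in> P \<Longrightarrow> (col p, col (\<pi> s p), s) \<in> E"
  shows "\<exists>x\<in>XG E. periodic x \<and> x fid = col p0"
proof -
  define act where "act p w = foldl (\<lambda>p s. \<pi> s p) p w" for p w
  have act_simps [simp]: "act p [] = p" "act p (w @ [s]) = \<pi> s (act p w)" for p w s
    by (simp_all add: act_def)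
  have act_in: "act p w \<in> P" if "p \<in> P" for p w
    by (induction w rule: rev_induct) (auto intro: \<pi> that)
  have act_app: "act p (app_letter w s) = \<pi> s (act p w)" if "p \<in> P" for p w s
  proof (cases "w \<noteq> [] \<and> last w = inv_letter s")
    case True
    then obtain v where "w = v @ [inv_letter s]"
      by (metis append_butlast_last_id)
    then show ?thesis
      using \<pi>(2)[OF act_in[OF that], of "inv_letter s" v] by (simp add: app_letter_def)
  qed (auto simp: app_letter_def)
  have act_mult: "act p (mult_words u v) = act (act p u) v" if "p \<in> P" for p u v
    by (induction v rule: rev_induct) (auto simp: act_app that)
  define x where "x f = col (act p0 (Rep_fgrp f))" for f
  have "x \<in> XG E"
    by (auto simp: XG_def x_def Rep_fmult_gen act_app p0 intro!: E act_in)
  moreover have "periodic x"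
  proof (rule periodic_if_finite_orbit)
    have "shift f x = (\<lambda>p g. col (act p (Rep_fgrp g))) (act p0 (Rep_fgrp (finv f)))" for f
      by (simp add: shift_def x_def Rep_fmult act_mult p0)
    then have "range (\<lambda>f. shift f x) \<subseteq> (\<lambda>p g. col (act p (Rep_fgrp g))) ` P"
      using act_in[OF p0] by blast
    then show "finite (range (\<lambda>f. shift f x))"
      using \<open>finite P\<close> finite_subset by blast
  qed
  ultimately show ?thesis by (auto simp: x_def)
qed

text \<open>The half-edges with label \<open>s0\<close> are declared to be the vertices. Balance
  matches them, colour by colour, with the half-edges of every label. To move along \<open>s\<close>
  from a vertex, take its matched \<open>s\<close>-half-edge, reverse it with \<open>\<rho>\<close>
  and pass to the vertex matched with the result.\<close>

lemma periodic_from_balanced_half_edges: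
  fixes E :: "('v \<times> 'v \<times> 'b letter) set" and \<rho> :: "'h \<Rightarrow> 'h"
  assumes "finite H" and h0: "h0 \<in> H"
    and \<rho>: "\<And>h. h \<in> H \<Longrightarrow> \<rho> h \<in> H" "\<And>h. h \<in> H \<Longrightarrow> \<rho> (\<rho> h) = h"
      "\<And>h. h \<in> H \<Longrightarrow> lab (\<rho> h) = inv_letter (lab h)"
    and E: "\<And>h. h \<in> H \<Longrightarrow> (col h, col (\<rho> h), lab h) \<in> E"
    and bal: "\<And>v s. card {h \<in> H. col h = v \<and> lab h = s} = card {h \<in> H. col h = v \<and> lab h = s0}"
  shows "\<exists>x\<in>XG E. periodic x \<and> x fid = col h0"
proof -
  define P where "P = {h \<in> H. lab h = s0}"
  have "\<exists>b. bij_betw b {h \<in> H. col h = v \<and> lab h = s0} {h \<in> H. col h = v \<and> lab h = s}" for v s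
    by (rule finite_same_card_bij[OF _ _ bal[symmetric]]) (use \<open>finite H\<close> in simp_all)
  then have "\<forall>v s. \<exists>b. bij_betw b {h \<in> H. col h = v \<and> lab h = s0} {h \<in> H. col h = v \<and> lab h = s}"
    by blast
  from this[unfolded choice_iff] obtain b where b:
    "\<And>v s. bij_betw (b v s) {h \<in> H. col h = v \<and> lab h = s0} {h \<in> H. col h = v \<and> lab h = s}"
    by blast
  define \<beta> where "\<beta> s h = b (col h) s h" for s h
  have \<beta>_in: "\<beta> s p \<in> H \<and> lab (\<beta> s p) = s \<and> col (\<beta> s p) = col p" if "p \<in> P" for s p
    using bij_betwE[OF b[of "col p" s]] that by (auto simp: \<beta>_def P_def)
  have \<beta>_inj: "inj_on (\<beta> s) P" for s
  proof (rule inj_onI)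
    fix p q assume pq: "p \<in> P" "q \<in> P" "\<beta> s p = \<beta> s q"
    then have "col p = col q" by (metis \<beta>_in)
    then show "p = q"
      using pq bij_betw_imp_inj_on[OF b[of "col q" s]]
      by (auto simp: \<beta>_def P_def inj_on_def)
  qed
  have \<beta>_surj: "h \<in> \<beta> (lab h) ` P" if "h \<in> H" for h
  proof -
    have "h \<in> b (col h) (lab h) ` {g \<in> H. col g = col h \<and> lab g = s0}"
      using bij_betw_imp_surj_on[OF b[of "col h" "lab h"]] that by auto
    then obtain g where "g \<in> P" "col g = col h" "h = b (col h) (lab h) g"
      by (auto simp: P_def)
    then show ?thesis by (intro image_eqI[of _ _ g]) (simp_all add: \<beta>_def)
  qed
  \<comment> \<open>\<open>\<beta> s p\<close> is the half-edge with label \<open>s\<close> attached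
    to the vertex \<open>p\<close>; \<open>\<gamma>\<close> recovers the vertex from an attached
    half-edge.\<close>
  define \<gamma> where "\<gamma> h = inv_into P (\<beta> (lab h)) h" for h
  have \<gamma>: "\<gamma> h \<in> P" "\<beta> (lab h) (\<gamma> h) = h" "col (\<gamma> h) = col h" if "h \<in> H" for h
  proof -
    show 1: "\<gamma> h \<in> P" and 2: "\<beta> (lab h) (\<gamma> h) = h"
      using \<beta>_surj[OF that] by (auto simp: \<gamma>_def intro: inv_into_into f_inv_into_f)
    show "col (\<gamma> h) = col h" using \<beta>_in[OF 1] 2 by metis
  qed
  have \<gamma>\<beta>: "\<gamma> (\<beta> s p) = p" if "p \<in> P" for s p
    using that \<beta>_in[OF that, of s] \<beta>_inj[of s] by (simp add: \<gamma>_def)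
  have "\<exists>x\<in>XG E. periodic x \<and> x fid = col (\<gamma> h0)"
  proof (rule periodic_from_permutations[where \<pi> = "\<lambda>s p. \<gamma> (\<rho> (\<beta> s p))" and P = P])
    show "finite P" using \<open>finite H\<close> by (simp add: P_def)
    show "\<gamma> h0 \<in> P" by (rule \<gamma>(1)[OF h0])
    fix s p assume p: "p \<in> P"
    show "\<gamma> (\<rho> (\<beta> s p)) \<in> P" using p \<beta>_in \<rho>(1) \<gamma>(1) by blast
    show "\<gamma> (\<rho> (\<beta> (inv_letter s) (\<gamma> (\<rho> (\<beta> s p))))) = p"
      using \<gamma>(2)[of "\<rho> (\<beta> s p)"] \<rho> \<beta>_in[OF p, of s] \<gamma>\<beta>[OF p] by simp
    show "(col p, col (\<gamma> (\<rho> (\<beta> s p))), s) \<in> E"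
      using E[of "\<beta> s p"] \<beta>_in[OF p, of s] \<gamma>(3)[of "\<rho> (\<beta> s p)"] \<rho>(1) by simp
  qed
  then show ?thesis using \<gamma>(3)[OF h0] by simp
qed

section \<open>Finite positive relations among integer vectors\<close>

lemma semigroup_nat_multiple:
  fixes M :: "('c \<Rightarrow> int) set"
  assumes add: "\<And>u v. u \<in> M \<Longrightarrow> v \<in> M \<Longrightarrow> (\<lambda>c. u c + v c) \<in> M" and zero: "(\<lambda>_. 0) \<in> M"
    and "u \<in> M" "0 \<le> k"
  shows "(\<lambda>c. k * u c) \<in> M"
  using \<open>0 \<le> k\<close>
proof (induction k rule: int_ge_induct)
  case base
  then show ?case using zero by simp
next
  case (step k)
  then show ?case using add[OF step(2) \<open>u \<in> M\<close>] by (simp add: algebra_simps)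
qed

text \<open>Stiemke's alternative for a possibly infinite family of vectors, by Fourier--Motzkin
  elimination of one coordinate at a time: each pair of vectors of opposite sign in the eliminated
  coordinate is replaced by its positive combination that vanishes there.\<close>

lemma stiemke_integer_vectors:
  fixes G M :: "('c \<Rightarrow> int) set"
  assumes "finite K"
    and "\<And>u v. u \<in> M \<Longrightarrow> v \<in> M \<Longrightarrow> (\<lambda>c. u c + v c) \<in> M" and "(\<lambda>_. 0) \<in> M"
    and "G \<subseteq> M"
    and "\<And>y :: 'c \<Rightarrow> real. \<forall>u\<in>G. 0 \<le> (\<Sum>c\<in>K. y c * u c) \<Longrightarrow> \<forall>u\<in>G. (\<Sum>c\<in>K. y c * u c) = 0"
    and "u \<in> G"
  shows "\<exists>v\<in>M. \<forall>c\<in>K. u c + v c = 0"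
  using assms
proof (induction K arbitrary: G M u rule: finite_induct)
  case empty
  then show ?case by blast
next
  case (insert c K)
  note add = insert.prems(1) and zero = insert.prems(2) and GM = insert.prems(3)
    and sep = insert.prems(4) and uG = insert.prems(5)
  have mult: "(\<lambda>d. k * w d) \<in> M" if "w \<in> M" "0 \<le> k" for w k
    by (rule semigroup_nat_multiple[OF add zero that])
  have comb: "(\<lambda>d. k * w d + l * z d) \<in> M" if "w \<in> M" "z \<in> M" "0 \<le> k" "0 \<le> l" for w z k l
    by (rule add[OF mult mult]) (use that in auto)
  define elim where "elim v w = (\<lambda>d. (- w c) * v d + v c * w d)" for v w :: "'c \<Rightarrow> int"
  define G' where "G' = {v \<in> G. v c = 0} \<union> {elim v w | v w. v \<in> G \<and> w \<in> G \<and> v c > 0 \<and> w c < 0}"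
  define M' where "M' = {v \<in> M. v c = 0}"
  have G'I: "elim v w \<in> G'" if "v \<in> G" "w \<in> G" "v c > 0" "w c < 0" for v w
    using that by (auto simp: G'_def)
  have e_c: "(\<Sum>d\<in>insert c K. (if d = c then r else 0) * of_int (v d)) = r * of_int (v c)" for r :: real and v :: "'c \<Rightarrow> int"
  proof -
    have "(\<Sum>d\<in>K. (if d = c then r else 0) * of_int (v d)) = 0"
      using insert.hyps by (intro sum.neutral) auto
    then show ?thesis using insert.hyps by simp
  qed
  \<comment> \<open>Test \<open>sep\<close> with the coordinate functional at \<open>c\<close>: were
    it nonnegative on \<open>G\<close>, it would vanish there. The opposite sign gives
    \<open>neg_pos\<close>.\<close>
  have pos_neg: "\<exists>w\<in>G. w c < 0" if "v \<in> G" "v c > 0" for v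
  proof (rule ccontr)
    assume "\<not> ?thesis"
    then have "\<forall>u\<in>G. 0 \<le> (\<Sum>d\<in>insert c K. (if d = c then 1 else 0) * real_of_int (u d))"
      unfolding e_c by auto
    from sep[OF this] that show False unfolding e_c by force
  qed
  have neg_pos: "\<exists>v\<in>G. v c > 0" if "w \<in> G" "w c < 0" for w
  proof (rule ccontr)
    assume "\<not> ?thesis"
    then have "\<forall>u\<in>G. 0 \<le> (\<Sum>d\<in>insert c K. (if d = c then - 1 else 0) * real_of_int (u d))"
      unfolding e_c by force
    from sep[OF this] that show False unfolding e_c by force
  qed
  have IH: "\<exists>v\<in>M'. \<forall>d\<in>K. z d + v d = 0" if "z \<in> G'" for z
  proof (rule insert.IH[OF _ _ _ _ that])
    show "(\<lambda>c. u c + v c) \<in> M'" if "u \<in> M'" "v \<in> M'" for u v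
      using that add by (auto simp: M'_def)
    show "(\<lambda>_. 0) \<in> M'" using zero by (simp add: M'_def)
    show "G' \<subseteq> M'"
    proof
      fix z assume "z \<in> G'"
      then consider "z \<in> G" "z c = 0"
        | v w where "z = elim v w" "v \<in> G" "w \<in> G" "v c > 0" "w c < 0"
        by (auto simp: G'_def)
      then show "z \<in> M'"
      proof cases
        case 1
        then show ?thesis using GM by (auto simp: M'_def)
      next
        case 2
        have "elim v w \<in> M"
          unfolding elim_def using 2 GM by (intro comb) auto
        then show ?thesis using 2 by (simp add: M'_def elim_def)
      qed
    qed
    fix y :: "'c \<Rightarrow> real"
    assume y: "\<forall>u\<in>G'. 0 \<le> (\<Sum>c\<in>K. y c * real_of_int (u c))"
    define L where "L u = (\<Sum>d\<in>K. y d * real_of_int (u d))" for u :: "'c \<Rightarrow> int"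
    have L_elim: "L (elim v w) = (- w c) * L v + v c * L w" for v w
      by (simp add: L_def elim_def sum_distrib_left sum.distrib sum_subtractf sum_negf algebra_simps)
    have le: "L w / w c \<le> L v / v c" if "v \<in> G" "w \<in> G" "v c > 0" "w c < 0" for v w
    proof -
      have "0 \<le> L (elim v w)" using y G'I[OF that] by (auto simp: L_def)
      then have "w c * L v \<le> v c * L w" by (simp add: L_elim)
      then show ?thesis using that by (simp add: field_simps)
    qed
    \<comment> \<open>A nonnegative functional on the eliminated system extends to \<open>c\<close>
      with coefficient \<open>- t\<close>: by \<open>le\<close>, quotients from negative coordinates
      lie below quotients from positive ones, and \<open>t\<close> must lie between. As
      \<open>G\<close> may be infinite, a supremum replaces the maximum.\<close>
    have "\<exists>t :: real. \<forall>u\<in>G. t * u c \<le> L u"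
    proof (cases "\<exists>v\<in>G. v c > 0")
      case True
      then obtain v where v: "v \<in> G" "v c > 0" by blast
      then obtain w where w: "w \<in> G" "w c < 0" using pos_neg by blast
      define T where "T = (\<lambda>w. L w / w c) ` {w\<in>G. w c < 0}"
      have T: "T \<noteq> {}" "bdd_above T"
        using w le[OF v(1) _ v(2)] by (auto simp: T_def intro!: bdd_aboveI)
      have "Sup T * u c \<le> L u" if u: "u \<in> G" for u
      proof -
        consider "u c = 0" | "u c > 0" | "u c < 0" by linarith
        then show ?thesis
        proof cases
          case 1
          then show ?thesis using u y by (auto simp: G'_def L_def)
        next
          case 2
          have "Sup T \<le> L u / u c"
            by (rule cSup_least[OF T(1)]) (use le[OF u _ 2] in \<open>auto simp: T_def\<close>)
          then show ?thesis using 2 by (simp add: field_simps)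
        next
          case 3
          have "L u / u c \<le> Sup T"
            by (rule cSup_upper[OF _ T(2)]) (use u 3 in \<open>auto simp: T_def\<close>)
          then show ?thesis using 3 by (simp add: field_simps)
        qed
      qed
      then show ?thesis by (intro exI[of _ "Sup T"] ballI)
    next
      case False
      then have "u c = 0" if "u \<in> G" for u
        using neg_pos that by (metis linorder_neqE_linordered_idom)
      then have "\<forall>u\<in>G. 0 * real_of_int (u c) \<le> L u"
        using y by (auto simp: G'_def L_def)
      then show ?thesis by (rule exI)
    qed
    then obtain t :: real where t: "\<forall>u\<in>G. t * u c \<le> L u" by blast
    have ext: "(\<Sum>d\<in>insert c K. (y(c := - t)) d * real_of_int (u d)) = L u - t * u c" for u
    proof -
      have "(\<Sum>d\<in>K. (y(c := - t)) d * real_of_int (u d)) = L u"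
        unfolding L_def using insert.hyps by (intro sum.cong) auto
      then show ?thesis using insert.hyps by simp
    qed
    have "\<forall>u\<in>G. 0 \<le> (\<Sum>d\<in>insert c K. (y(c := - t)) d * real_of_int (u d))"
      unfolding ext using t by simp
    from sep[OF this] have eq: "L u = t * u c" if "u \<in> G" for u
      unfolding ext using that by simp
    have "L z = 0" if "z \<in> G'" for z
      using that by (auto simp: G'_def eq L_elim)
    then show "\<forall>u\<in>G'. (\<Sum>c\<in>K. y c * real_of_int (u c)) = 0"
      by (simp add: L_def)
  qed
  consider "u c = 0" | "u c > 0" | "u c < 0" by linarith
  then show ?case
  proof cases
    case 1
    then obtain v where "v \<in> M'" "\<forall>d\<in>K. u d + v d = 0"
      using IH[of u] uG by (auto simp: G'_def)
    then show ?thesis using 1 by (auto simp: M'_def)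
  next
    case 2
    obtain w where w: "w \<in> G" "w c < 0" using pos_neg uG 2 by blast
    obtain m where m: "m \<in> M'" "\<forall>d\<in>K. elim u w d + m d = 0"
      using IH[OF G'I[OF uG w(1) 2 w(2)]] by blast
    \<comment> \<open>\<open>elim u w\<close> contains \<open>u\<close> with coefficient
      \<open>- w c\<close>, which is at least one because coordinates are integers. Setting one copy
      of \<open>u\<close> aside leaves the required partner, still with nonnegative
      coefficients.\<close>
    have "(\<lambda>d. ((- w c - 1) * u d + u c * w d) + m d) \<in> M"
      using uG w GM m 2 by (intro add comb) (auto simp: M'_def)
    then show ?thesis
      by (rule bexI[rotated]) (use m in \<open>auto simp: M'_def elim_def algebra_simps\<close>)
  next
    case 3
    obtain v where v: "v \<in> G" "v c > 0" using neg_pos uG 3 by blast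
    obtain m where m: "m \<in> M'" "\<forall>d\<in>K. elim v u d + m d = 0"
      using IH[OF G'I[OF v(1) uG v(2) 3]] by blast
    have "(\<lambda>d. ((v c - 1) * u d + (- u c) * v d) + m d) \<in> M"
      using uG v GM m 3 by (intro add comb) (auto simp: M'_def)
    then show ?thesis
      by (rule bexI[rotated]) (use m in \<open>auto simp: M'_def elim_def algebra_simps\<close>)
  qed
qed

section \<open>Blocks of half-edges\<close>

text \<open>The pair \<open>(f, s)\<close> is the half of the Cayley edge from \<open>f\<close> to \<open>fs\<close> at its end \<open>f\<close>.
  A block is a connected piece that remains when the tree is cut at every vertex whose colour
  lies in \<open>A\<close>; the cut vertices are split into their half-edges.\<close>

definition hrev :: "'b fgrp \<times> 'b letter \<Rightarrow> 'b fgrp \<times> 'b letter" where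
  "hrev h = (fmult (fst h) (gen (snd h)), inv_letter (snd h))"

definition hstep :: "'v set \<Rightarrow> ('b fgrp \<Rightarrow> 'v) \<Rightarrow> (('b fgrp \<times> 'b letter) \<times> ('b fgrp \<times> 'b letter)) set" where
  "hstep A x = {(h, h'). h' = hrev h \<or> (fst h' = fst h \<and> x (fst h) \<notin> A)}"

definition block :: "'v set \<Rightarrow> ('b fgrp \<Rightarrow> 'v) \<Rightarrow> 'b fgrp \<times> 'b letter \<Rightarrow> ('b fgrp \<times> 'b letter) set" where
  "block A x h = {h'. (h, h') \<in> (hstep A x)\<^sup>*}"

definition htrans :: "'b fgrp \<Rightarrow> 'b fgrp \<times> 'b letter \<Rightarrow> 'b fgrp \<times> 'b letter" where
  "htrans g h = (fmult g (fst h), snd h)"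

lemma hrev_hrev [simp]: "hrev (hrev h) = h"
  by (simp add: hrev_def)

lemma hstep_sym: "(h, h') \<in> hstep A x \<Longrightarrow> (h', h) \<in> hstep A x"
  by (auto simp: hstep_def)

lemma block_refl [simp]: "h \<in> block A x h"
  by (simp add: block_def)

lemma block_commute: "h' \<in> block A x h \<longleftrightarrow> h \<in> block A x h'"
proof -
  have "sym ((hstep A x)\<^sup>*)"
    by (intro sym_rtrancl symI) (rule hstep_sym)
  then show ?thesis unfolding block_def mem_Collect_eq by (blast dest: symD)
qed

lemma block_subset: "h' \<in> block A x h \<Longrightarrow> block A x h' \<subseteq> block A x h"
  by (auto simp: block_def)

lemma block_eq: "h' \<in> block A x h \<Longrightarrow> block A x h' = block A x h"
  using block_subset block_commute by blast

lemma block_hrev: "h' \<in> block A x h \<Longrightarrow> hrev h' \<in> block A x h"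
  unfolding block_def hstep_def by (auto intro: rtrancl_into_rtrancl)

lemma block_vertex:
  "h' \<in> block A x h \<Longrightarrow> x (fst h') \<notin> A \<Longrightarrow> (fst h', s) \<in> block A x h"
  unfolding block_def hstep_def by (auto intro: rtrancl_into_rtrancl)

lemma block_least:
  assumes "h \<in> B" and "\<And>h'. h' \<in> B \<Longrightarrow> hrev h' \<in> B"
    and "\<And>h' s. h' \<in> B \<Longrightarrow> x (fst h') \<notin> A \<Longrightarrow> (fst h', s) \<in> B"
  shows "block A x h \<subseteq> B"
proof
  fix k assume "k \<in> block A x h"
  then have "(h, k) \<in> (hstep A x)\<^sup>*" by (simp add: block_def)
  then show "k \<in> B"
  proof induction
    case (step k l)
    then show ?case
      using assms(2)[of k] assms(3)[of k "snd l"] by (cases l) (auto simp: hstep_def)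
  qed (rule assms)
qed

text \<open>Each step of a path in the block consults only the colour of a vertex met by the block,
  cut vertices at its rim included. So a finite block is shared by all configurations in one
  cylinder.\<close>

lemma block_cong:
  assumes "\<And>k. k \<in> block A x h \<Longrightarrow> x' (fst k) = x (fst k)"
  shows "block A x' h = block A x h"
proof
  show 1: "block A x' h \<subseteq> block A x h"
    by (rule block_least) (auto intro: block_hrev block_vertex simp: assms)
  show "block A x h \<subseteq> block A x' h"
  proof
    fix k assume "k \<in> block A x h"
    then have "(h, k) \<in> (hstep A x)\<^sup>*" by (simp add: block_def)
    then show "k \<in> block A x' h"
    proof induction
      case (step k l)
      then have "(k, l) \<in> hstep A x'"
        using assms[of k] by (auto simp: hstep_def block_def)
      with step show ?case by (auto simp: block_def)
    qed simp
  qed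
qed

section \<open>Equivariance of blocks under shifts\<close>

lemma inj_htrans: "inj (htrans g)"
  by (rule inj_on_inverseI[of _ "htrans (finv g)"]) (simp add: htrans_def)

lemma htrans_htrans_finv [simp]: "htrans g (htrans (finv g) h) = h"
  by (simp add: htrans_def)

lemma hrev_htrans: "hrev (htrans g h) = htrans g (hrev h)"
  by (simp add: htrans_def hrev_def fmult_assoc)

lemma block_shift_subset: "block A (shift g x) (htrans g h) \<subseteq> htrans g ` block A x h"
proof (rule block_least)
  fix h' s assume h': "h' \<in> htrans g ` block A x h" "shift g x (fst h') \<notin> A"
  then obtain k where k: "k \<in> block A x h" "h' = htrans g k" by blast
  then have "(fst k, s) \<in> block A x h"
    using h' by (intro block_vertex) (auto simp: shift_def htrans_def)
  then show "(fst h', s) \<in> htrans g ` block A x h"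
    using k by (auto simp: htrans_def intro: rev_image_eqI)
qed (auto simp: hrev_htrans intro: block_hrev)

lemma block_shift: "block A (shift g x) (htrans g h) = htrans g ` block A x h"
proof (rule antisym[OF block_shift_subset])
  have "block A x h \<subseteq> htrans (finv g) ` block A (shift g x) (htrans g h)"
    using block_shift_subset[of A "finv g" "shift g x" "htrans g h"]
    by (simp add: shift_shift htrans_def)
  then show "htrans g ` block A x h \<subseteq> block A (shift g x) (htrans g h)"
    by auto
qed

text \<open>Maximality in \<open>S_component\<close> gives no existence by itself; the class of
  \<open>f\<close> under steps inside \<open>F0\<close> is a component. Its closure under such steps
  is what bounds blocks below.\<close>

lemma component_exists:
  fixes f :: "'b fgrp"
  assumes "f \<in> F0"
  obtains C where "S_component F0 C" "f \<in> C"
    "\<And>u s. u \<in> C \<Longrightarrow> fmult u (gen s) \<in> F0 \<Longrightarrow> fmult u (gen s) \<in> C"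
proof -
  define R where "R = {(u, v). u \<in> F0 \<and> v \<in> F0 \<and> (\<exists>s. v = fmult u (gen s))}"
  define C where "C = {g. (f, g) \<in> R\<^sup>*}"
  have "sym R"
  proof (rule symI)
    fix u v assume "(u, v) \<in> R"
    then obtain s where "u \<in> F0" "v \<in> F0" "v = fmult u (gen s)" by (auto simp: R_def)
    then show "(v, u) \<in> R"
      unfolding R_def using fmult_gen_cancel[of u s, symmetric] by blast
  qed
  then have symR: "sym (R\<^sup>*)" by (rule sym_rtrancl)
  have C_F0: "C \<subseteq> F0"
  proof
    fix g assume "g \<in> C"
    then have "(f, g) \<in> R\<^sup>*" by (simp add: C_def)
    then show "g \<in> F0" by cases (use assms in \<open>auto simp: R_def\<close>)
  qed
  have path: "\<exists>p. p \<noteq> [] \<and> hd p = u \<and> last p = v \<and> set p \<subseteq> C \<and>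
      (\<forall>i. Suc i < length p \<longrightarrow> (\<exists>s. p ! Suc i = fmult (p ! i) (gen s)))"
    if "u \<in> C" "(u, v) \<in> R\<^sup>*" for u v
    using that(2)
  proof induction
    case base
    show ?case using that(1) by (intro exI[of _ "[u]"]) simp
  next
    case (step v w)
    then obtain p where p: "p \<noteq> []" "hd p = u" "last p = v" "set p \<subseteq> C"
      "\<And>i. Suc i < length p \<Longrightarrow> \<exists>s. p ! Suc i = fmult (p ! i) (gen s)" by blast
    have "w \<in> C" using step(1,2) that(1) by (auto simp: C_def)
    moreover have "\<exists>s. (p @ [w]) ! Suc i = fmult ((p @ [w]) ! i) (gen s)"
      if "Suc i < length (p @ [w])" for i
    proof (cases "Suc i < length p")
      case True
      then show ?thesis using p(5) by (simp add: nth_append)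
    next
      case False
      then have "i = length p - 1" "i < length p" "Suc i = length p" using that p(1) by auto
      then show ?thesis
        using step(2) p(1,3) by (auto simp: nth_append R_def last_conv_nth)
    qed
    ultimately show ?case using p by (intro exI[of _ "p @ [w]"]) simp
  qed
  have "S_connected C"
    unfolding S_connected_def
  proof (intro ballI)
    fix u v assume uv: "u \<in> C" "v \<in> C"
    then have "(u, v) \<in> R\<^sup>*"
      unfolding C_def mem_Collect_eq using symD[OF symR] rtrancl_trans by metis
    then show "\<exists>p. p \<noteq> [] \<and> hd p = u \<and> last p = v \<and> set p \<subseteq> C \<and>
      (\<forall>i. Suc i < length p \<longrightarrow> (\<exists>s. p ! Suc i = fmult (p ! i) (gen s)))"
      by (rule path[OF uv(1)])
  qed
  moreover have "D \<subseteq> C" if D: "C \<subseteq> D" "D \<subseteq> F0" "S_connected D" for D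
  proof
    fix d assume "d \<in> D"
    moreover have "f \<in> D" using D(1) by (auto simp: C_def)
    ultimately obtain p where p: "p \<noteq> []" "hd p = f" "last p = d" "set p \<subseteq> D"
      "\<And>i. Suc i < length p \<Longrightarrow> \<exists>s. p ! Suc i = fmult (p ! i) (gen s)"
      using D(3) unfolding S_connected_def by metis
    have "(f, p ! i) \<in> R\<^sup>*" if "i < length p" for i
      using that
    proof (induction i)
      case 0
      then show ?case using p(1,2) by (simp add: hd_conv_nth)
    next
      case (Suc i)
      then have "p ! i \<in> F0" "p ! Suc i \<in> F0" using p(4) D(2) nth_mem by (meson Suc_lessD subsetD)+
      then have "(p ! i, p ! Suc i) \<in> R" using p(5)[OF Suc.prems] by (simp add: R_def)
      then show ?case using Suc by (auto intro: rtrancl_into_rtrancl)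
    qed
    then have "(f, d) \<in> R\<^sup>*"
      using p(1,3) by (metis last_conv_nth length_greater_0_conv diff_less zero_less_one)
    then show "d \<in> C" by (simp add: C_def)
  qed
  ultimately have "S_component F0 C"
    using C_F0 unfolding S_component_def by blast
  moreover have "fmult u (gen s) \<in> C" if "u \<in> C" "fmult u (gen s) \<in> F0" for u s
  proof -
    have "(u, fmult u (gen s)) \<in> R" using that C_F0 unfolding R_def by blast
    then show ?thesis using that by (auto simp: C_def)
  qed
  ultimately show ?thesis by (intro that[of C]) (auto simp: C_def)
qed

text \<open>A block through an uncut vertex cannot leave the component of that vertex except by a
  final half-edge, so it consists of half-edges at the component and their reverses. If both ends of
  an edge are cut, the block is that edge alone.\<close>

lemma finite_block:
  fixes x :: "'b::finite fgrp \<Rightarrow> 'v"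
  assumes fin: "\<And>C. S_component (x -` (UNIV - A)) C \<Longrightarrow> finite C"
  shows "finite (block A x h)"
proof -
  have *: "finite (block A x h)" if hA: "x (fst h) \<notin> A" for h
  proof -
    obtain C where C: "S_component (x -` (UNIV - A)) C" "fst h \<in> C"
      "\<And>u s. u \<in> C \<Longrightarrow> fmult u (gen s) \<in> x -` (UNIV - A) \<Longrightarrow> fmult u (gen s) \<in> C"
    proof (rule component_exists)
      show "fst h \<in> x -` (UNIV - A)" using hA by simp
    qed blast
    have "block A x h \<subseteq> C \<times> UNIV \<union> hrev ` (C \<times> UNIV)"
    proof (rule block_least)
      show "h \<in> C \<times> UNIV \<union> hrev ` (C \<times> UNIV)" using C(2) by (cases h) auto
    next
      fix h' assume "h' \<in> C \<times> UNIV \<union> hrev ` (C \<times> UNIV)"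
      then show "hrev h' \<in> C \<times> UNIV \<union> hrev ` (C \<times> UNIV)" by fastforce
    next
      fix h' s assume "h' \<in> C \<times> UNIV \<union> hrev ` (C \<times> UNIV)" "x (fst h') \<notin> A"
      then have "fst h' \<in> C" using C(3) unfolding hrev_def by fastforce
      then show "(fst h', s) \<in> C \<times> UNIV \<union> hrev ` (C \<times> UNIV)" by simp
    qed
    moreover have "finite (C \<times> (UNIV :: 'b letter set))"
      using fin[OF C(1)] by simp
    ultimately show ?thesis by (meson finite_UnI finite_imageI finite_subset)
  qed
  consider "x (fst h) \<notin> A" | "x (fst (hrev h)) \<notin> A" | "x (fst h) \<in> A" "x (fst (hrev h)) \<in> A"
    by blast
  then show ?thesis
  proof cases
    case 2
    then show ?thesis using *[of "hrev h"] block_eq[OF block_hrev[OF block_refl]] by metis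
  next
    case 3
    then have "block A x h \<subseteq> {h, hrev h}"
      by (intro block_least) auto
    then show ?thesis by (rule finite_subset) simp
  qed (rule *)
qed

section \<open>Colour counts and the gluing of blocks\<close>

definition colour_count :: "('b fgrp \<Rightarrow> 'v) \<Rightarrow> ('b fgrp \<times> 'b letter) set \<Rightarrow> 'v \<Rightarrow> 'b letter \<Rightarrow> nat" where
  "colour_count x H v s = card {h \<in> H. x (fst h) = v \<and> snd h = s}"

text \<open>An uncut vertex contributes all of its half-edges or none, so changing the label at a
  fixed vertex is a bijection.\<close>

lemma colour_count_block_outside:
  assumes "v \<notin> A"
  shows "colour_count x (block A x h) v s = colour_count x (block A x h) v t"
proof -
  have "bij_betw (\<lambda>h. (fst h, t)) {k \<in> block A x h. x (fst k) = v \<and> snd k = s}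
      {k \<in> block A x h. x (fst k) = v \<and> snd k = t}"
    by (rule bij_betw_byWitness[where f' = "\<lambda>h. (fst h, s)"])
      (use assms in \<open>auto intro: block_vertex[of "(_, _)", simplified]\<close>)
  then show ?thesis unfolding colour_count_def by (rule bij_betw_same_card)
qed

text \<open>The balance equations as one integer vector per block, with \<open>s0\<close> as
  reference label; a family of finite blocks can be glued once these vectors add up to zero on
  \<open>A\<close>.\<close>

definition excess :: "'b letter \<Rightarrow> ('b fgrp \<Rightarrow> 'v) \<Rightarrow> ('b fgrp \<times> 'b letter) set \<Rightarrow> 'v \<times> 'b letter \<Rightarrow> int" where
  "excess s0 x H c = int (colour_count x H (fst c) (snd c)) - int (colour_count x H (fst c) s0)"

lemma periodic_from_balanced_blocks:
  fixes E :: "('v \<times> 'v \<times> 'b letter) set" and l :: "(('b fgrp \<Rightarrow> 'v) \<times> 'b letter) list"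
  assumes l: "\<And>x s. (x, s) \<in> set l \<Longrightarrow> x \<in> XG E \<and> finite (block A x (fid, s))"
    and bal: "\<And>a t. a \<in> A \<Longrightarrow> (\<Sum>(x, s)\<leftarrow>l. excess s0 x (block A x (fid, s)) (a, t)) = 0"
    and x0: "(x0, t0) \<in> set l"
  shows "\<exists>x\<in>XG E. periodic x \<and> x fid = x0 fid"
proof -
  define X where "X k = fst (l ! k)" for k
  define B where "B k = block A (X k) (fid, snd (l ! k))" for k
  have X: "X k \<in> XG E" and B: "finite (B k)" if "k < length l" for k
    using l[of "fst (l ! k)" "snd (l ! k)"] that by (auto simp: X_def B_def)
  \<comment> \<open>The index keeps copies apart: a block may occur in \<open>l\<close> repeatedly,
    and blocks of different configurations may overlap in the group.\<close>
  define H where "H = (SIGMA k:{..<length l}. B k)"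
  have count: "card {h \<in> H. X (fst h) (fst (snd h)) = v \<and> snd (snd h) = s}
      = (\<Sum>k<length l. colour_count (X k) (B k) v s)" for v s
  proof -
    have "{h \<in> H. X (fst h) (fst (snd h)) = v \<and> snd (snd h) = s}
        = (SIGMA k:{..<length l}. {h \<in> B k. X k (fst h) = v \<and> snd h = s})"
      by (auto simp: H_def)
    then show ?thesis using B by (simp add: colour_count_def)
  qed
  have balance: "(\<Sum>k<length l. colour_count (X k) (B k) v s)
      = (\<Sum>k<length l. colour_count (X k) (B k) v s0)" for v s
  proof (cases "v \<in> A")
    case True
    have "(\<Sum>k<length l. excess s0 (X k) (B k) (v, s)) = 0"
      using bal[OF True, of s]
      by (simp add: sum_list_sum_nth X_def B_def case_prod_unfold atLeast0LessThan)
    then have "int (\<Sum>k<length l. colour_count (X k) (B k) v s)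
        = int (\<Sum>k<length l. colour_count (X k) (B k) v s0)"
      by (simp add: excess_def sum_subtractf)
    then show ?thesis by linarith
  next
    case False
    then show ?thesis
      by (intro sum.cong refl) (simp add: B_def colour_count_block_outside[of v A _ _ s s0])
  qed
  obtain k0 where k0: "k0 < length l" "l ! k0 = (x0, t0)"
    using x0 by (auto simp: in_set_conv_nth)
  have "\<exists>x\<in>XG E. periodic x \<and> x fid = (\<lambda>h. X (fst h) (fst (snd h))) (k0, (fid, t0))"
  proof (rule periodic_from_balanced_half_edges[where H = H and \<rho> = "\<lambda>h. (fst h, hrev (snd h))"
        and lab = "\<lambda>h. snd (snd h)" and ?s0.0 = s0])
    show "finite H" using B by (auto simp: H_def)
    show "(k0, (fid, t0)) \<in> H" using k0 by (auto simp: H_def B_def)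
    fix h assume h: "h \<in> H"
    show "(fst h, hrev (snd h)) \<in> H" using h by (auto simp: H_def B_def intro: block_hrev)
    show "(X (fst h) (fst (snd h)), X (fst (fst h, hrev (snd h))) (fst (snd (fst h, hrev (snd h)))),
        snd (snd h)) \<in> E"
    proof -
      have "X (fst h) \<in> XG E" using h X by (auto simp: H_def)
      then show ?thesis unfolding XG_def hrev_def mem_Collect_eq fst_conv snd_conv by blast
    qed
  next
    show "card {h \<in> H. X (fst h) (fst (snd h)) = v \<and> snd (snd h) = s}
      = card {h \<in> H. X (fst h) (fst (snd h)) = v \<and> snd (snd h) = s0}" for v s
      unfolding count by (rule balance)
  qed (simp_all add: hrev_def)
  then show ?thesis using k0 by (simp add: X_def)
qed

section \<open>Mass transport over blocks\<close>

text \<open>The group moves only the first component of a half-edge, so transported mass is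
  integrated over the group for each label; mass on a finite block then becomes a finite
  sum.\<close>

lemma sum_nn_integral_half_edges:
  fixes F :: "'g \<times> 's::finite \<Rightarrow> ennreal"
  assumes "finite B" and "\<And>h. h \<notin> B \<Longrightarrow> F h = 0"
  shows "(\<Sum>s\<in>UNIV. \<integral>\<^sup>+g. F (g, s) \<partial>count_space UNIV) = (\<Sum>h\<in>B. F h)"
proof -
  have "(\<integral>\<^sup>+g. F (g, s) \<partial>count_space UNIV) = (\<Sum>g\<in>fst ` B. F (g, s))" for s
    by (rule nn_integral_count_space') (use assms in \<open>force+\<close>)
  then have "(\<Sum>s\<in>UNIV. \<integral>\<^sup>+g. F (g, s) \<partial>count_space UNIV) = (\<Sum>g\<in>fst ` B. \<Sum>s\<in>UNIV. F (g, s))"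
    by (simp add: sum.swap[of _ "fst ` B"])
  also have "\<dots> = (\<Sum>h\<in>fst ` B \<times> UNIV. F h)"
    by (simp add: sum.cartesian_product case_prod_beta)
  also have "\<dots> = (\<Sum>h\<in>B. F h)"
    by (rule sum.mono_neutral_right) (use assms in \<open>force+\<close>)
  finally show ?thesis .
qed

lemma borel_measurable_nn_integral_count_space:
  fixes f :: "'i::countable \<Rightarrow> 'a \<Rightarrow> ennreal"
  assumes "\<And>i. f i \<in> borel_measurable M"
  shows "(\<lambda>x. \<integral>\<^sup>+i. f i x \<partial>count_space UNIV) \<in> borel_measurable M"
proof -
  interpret sigma_finite_measure "count_space (UNIV :: 'i set)"
    by (rule sigma_finite_measure_count_space_countable) simp
  have "(\<lambda>(i, x). f i x) \<in> borel_measurable (count_space UNIV \<Otimes>\<^sub>M M)"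
    by (rule measurable_pair_measure_countable1) (simp_all add: assms)
  then have "(\<lambda>(x, i). f i x) \<in> borel_measurable (M \<Otimes>\<^sub>M count_space UNIV)"
    using measurable_pair_swap by fastforce
  then show ?thesis by (rule borel_measurable_nn_integral)
qed

locale invariant_subshift_measure = prob_space \<mu>
  for \<mu> :: "('b::finite fgrp \<Rightarrow> 'v::countable) measure" +
  fixes E :: "('v \<times> 'v \<times> 'b letter) set" and A :: "'v set"
  assumes sets_\<mu>: "sets \<mu> = sets (restrict_space config_space (XG E))"
    and space_\<mu>: "space \<mu> = XG E"
    and shift_invariant: "B \<in> sets \<mu> \<Longrightarrow> emeasure \<mu> (shift g -` B \<inter> space \<mu>) = emeasure \<mu> B"
begin

section \<open>Invariance of integrals and measurability of blocks\<close>

lemma measurable_coordinate [measurable]: "(\<lambda>x. x f) \<in> measurable \<mu> (count_space UNIV)"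
proof -
  have "(\<lambda>x. x f) \<in> measurable (config_space :: ('b fgrp \<Rightarrow> 'v) measure) (count_space UNIV)"
    unfolding config_space_def by (rule measurable_component_singleton) simp
  then have "(\<lambda>x. x f) \<in> measurable (restrict_space config_space (XG E)) (count_space UNIV)"
    by (rule measurable_restrict_space1)
  then show ?thesis using measurable_cong_sets[OF sets_\<mu> refl] by blast
qed

lemma measurable_of_coordinate [measurable]: "(\<lambda>x. F (x f)) \<in> borel_measurable \<mu>"
  by (rule measurable_compose[OF measurable_coordinate]) simp

lemma measurable_shift: "shift g \<in> measurable \<mu> \<mu>"
proof -
  have "shift g \<in> measurable \<mu> config_space"
    unfolding config_space_def shift_def by (rule measurable_PiM_single') auto
  then have "shift g \<in> measurable \<mu> (restrict_space config_space (XG E))"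
    by (intro measurable_restrict_space2) (auto simp: space_\<mu> shift_in_XG)
  then show ?thesis using measurable_cong_sets[OF refl sets_\<mu>] by blast
qed

lemma nn_integral_shift:
  assumes "F \<in> borel_measurable \<mu>"
  shows "(\<integral>\<^sup>+x. F (shift g x) \<partial>\<mu>) = (\<integral>\<^sup>+x. F x \<partial>\<mu>)"
proof -
  have "distr \<mu> \<mu> (shift g) = \<mu>"
    by (rule measure_eqI) (simp_all add: emeasure_distr measurable_shift shift_invariant)
  then show ?thesis
    using nn_integral_distr[OF measurable_shift, of F g] assms by simp
qed

lemma pred_mem_block [measurable]: "Measurable.pred \<mu> (\<lambda>x. h' \<in> block A x h)"
proof -
  have "Measurable.pred \<mu> (\<lambda>x. (h, h') \<in> hstep A x ^^ n)" for n h'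
  proof (induction n arbitrary: h')
    case (Suc n)
    note Suc.IH [measurable]
    have "(\<lambda>x. (h, h') \<in> hstep A x ^^ Suc n) = (\<lambda>x. \<exists>k. (h, k) \<in> hstep A x ^^ n \<and>
        (h' = hrev k \<or> (fst h' = fst k \<and> x (fst k) \<notin> A)))"
      by (auto simp: hstep_def relcomp_unfold fun_eq_iff)
    then show ?case by simp
  qed simp
  then have "Measurable.pred \<mu> (\<lambda>x. \<exists>n. (h, h') \<in> hstep A x ^^ n)"
    by (rule pred_intros_countable)
  then show ?thesis by (simp add: block_def rtrancl_power)
qed

lemma measurable_card_block [measurable]:
  "(\<lambda>x. card (block A x h)) \<in> measurable \<mu> (count_space UNIV)"
proof -
  define J :: "('b fgrp \<times> 'b letter) set set" where "J = {H. finite H}"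
  \<comment> \<open>The empty set encodes an infinite block: no block is empty, and
    \<open>card\<close> is zero for both. Only countably many values remain.\<close>
  define \<phi> where "\<phi> x = (if finite (block A x h) then block A x h else {})" for x :: "'b fgrp \<Rightarrow> 'v"
  have "\<phi> \<in> measurable \<mu> (count_space J)"
  proof (subst measurable_count_space_eq_countable)
    show J: "countable J"
      unfolding J_def by (rule countable_Collect_finite)
    have eq: "\<phi> -` {H} \<inter> space \<mu> \<in> sets \<mu>" if "finite H" "H \<noteq> {}" for H
    proof -
      have "\<phi> x = H \<longleftrightarrow> (\<forall>k. k \<in> block A x h \<longleftrightarrow> k \<in> H)" for x
        unfolding \<phi>_def set_eq_iff[symmetric] using that by (cases "finite (block A x h)") auto
      then have "\<phi> -` {H} \<inter> space \<mu> = {x \<in> space \<mu>. \<forall>k. k \<in> block A x h \<longleftrightarrow> k \<in> H}"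
        by blast
      also have "\<dots> \<in> sets \<mu>" by measurable
      finally show ?thesis .
    qed
    have \<phi>_J: "\<phi> x \<in> J" for x by (simp add: \<phi>_def J_def)
    then have "\<phi> -` {{}} \<inter> space \<mu> = space \<mu> - (\<Union>H\<in>J - {{}}. \<phi> -` {H} \<inter> space \<mu>)"
      by (intro set_eqI) auto
    also have "\<dots> \<in> sets \<mu>"
      using J eq by (intro sets.Diff sets.top sets.countable_UN') (auto simp: J_def)
    finally have "\<phi> -` {{}} \<inter> space \<mu> \<in> sets \<mu>" .
    show "\<phi> \<in> space \<mu> \<rightarrow> J \<and> (\<forall>H\<in>J. \<phi> -` {H} \<inter> space \<mu> \<in> sets \<mu>)"
    proof (intro conjI ballI Pi_I \<phi>_J)
      fix H assume "H \<in> J"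
      then show "\<phi> -` {H} \<inter> space \<mu> \<in> sets \<mu>"
        using eq[of H] \<open>\<phi> -` {{}} \<inter> space \<mu> \<in> sets \<mu>\<close> by (cases "H = {}") (simp_all add: J_def)
    qed
  qed
  then have "(\<lambda>x. card (\<phi> x)) \<in> measurable \<mu> (count_space UNIV)"
    by (rule measurable_compose) simp
  moreover have "card (\<phi> x) = card (block A x h)" for x by (simp add: \<phi>_def)
  ultimately show ?thesis by simp
qed

text \<open>Each half-edge spreads its weight uniformly over its block; infinite blocks have
  \<open>card\<close> zero and hence, as \<open>r / 0 = 0\<close>, transport nothing.\<close>

definition transport :: "('v \<Rightarrow> 'b letter \<Rightarrow> real) \<Rightarrow> 'b fgrp \<times> 'b letter \<Rightarrow> 'b fgrp \<times> 'b letter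
    \<Rightarrow> ('b fgrp \<Rightarrow> 'v) \<Rightarrow> ennreal" where
  "transport w h h' x =
    (if h' \<in> block A x h then ennreal (w (x (fst h)) (snd h) / card (block A x h)) else 0)"

lemma measurable_transport [measurable]: "transport w h h' \<in> borel_measurable \<mu>"
proof -
  have [measurable]: "(\<lambda>x. real (card (block A x h))) \<in> borel_measurable \<mu>"
    by (rule measurable_compose[OF measurable_card_block]) simp
  have [measurable]: "(\<lambda>x. w (x (fst h)) (snd h)) \<in> borel_measurable \<mu>"
    by (rule measurable_of_coordinate)
  show ?thesis unfolding transport_def by measurable
qed

lemma transport_shift:
  "transport w (htrans g h) (htrans g h') (shift g x) = transport w h h' x"
proof -
  have "card (block A (shift g x) (htrans g h)) = card (block A x h)"
    unfolding block_shift by (rule card_image) (rule inj_on_subset[OF inj_htrans subset_UNIV])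
  moreover have "htrans g h' \<in> block A (shift g x) (htrans g h) \<longleftrightarrow> h' \<in> block A x h"
    unfolding block_shift by (rule inj_image_mem_iff[OF inj_htrans])
  ultimately show ?thesis
    by (simp add: transport_def) (simp add: htrans_def shift_def)
qed

text \<open>By invariance, the mean mass sent from the identity to \<open>g\<close> is that sent
  from \<open>finv g\<close> to the identity, and \<open>finv\<close> permutes the group. So mean
  mass leaving the identity equals mean mass arriving there.\<close>

lemma mass_transport:
  "(\<integral>\<^sup>+x. (\<Sum>s\<in>UNIV. \<Sum>s'\<in>UNIV. \<integral>\<^sup>+g. transport w (fid, s) (g, s') x \<partial>count_space UNIV) \<partial>\<mu>)
    = (\<integral>\<^sup>+x. (\<Sum>s'\<in>UNIV. \<Sum>s\<in>UNIV. \<integral>\<^sup>+g. transport w (g, s) (fid, s') x \<partial>count_space UNIV) \<partial>\<mu>)"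
proof -
  have meas [measurable]: "(\<lambda>x. \<integral>\<^sup>+g. transport w (u g) (v g) x \<partial>count_space UNIV) \<in> borel_measurable \<mu>"
    for u v :: "'b fgrp \<Rightarrow> _"
    by (rule borel_measurable_nn_integral_count_space) simp_all
  have swap: "(\<integral>\<^sup>+x. \<integral>\<^sup>+g. transport w (u g) (v g) x \<partial>count_space UNIV \<partial>\<mu>)
      = (\<integral>\<^sup>+g. \<integral>\<^sup>+x. transport w (u g) (v g) x \<partial>\<mu> \<partial>count_space UNIV)"
    for u v :: "'b fgrp \<Rightarrow> _"
    by (rule nn_integral_count_space_nn_integral) simp_all
  have move: "(\<integral>\<^sup>+x. transport w (fid, s) (g, s') x \<partial>\<mu>)
      = (\<integral>\<^sup>+x. transport w (finv g, s) (fid, s') x \<partial>\<mu>)" for g s s'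
  proof -
    have "(\<integral>\<^sup>+x. transport w (fid, s) (g, s') x \<partial>\<mu>)
        = (\<integral>\<^sup>+x. transport w (fid, s) (g, s') (shift g x) \<partial>\<mu>)"
      by (rule nn_integral_shift[symmetric]) simp
    also have "\<dots> = (\<integral>\<^sup>+x. transport w (finv g, s) (fid, s') x \<partial>\<mu>)"
      using transport_shift[of w g "(finv g, s)" "(fid, s')"] by (simp add: htrans_def)
    finally show ?thesis .
  qed
  have bij: "bij (finv :: 'b fgrp \<Rightarrow> _)"
    by (rule involuntory_imp_bij) simp
  have "(\<integral>\<^sup>+x. (\<Sum>s\<in>UNIV. \<Sum>s'\<in>UNIV. \<integral>\<^sup>+g. transport w (fid, s) (g, s') x \<partial>count_space UNIV) \<partial>\<mu>)
      = (\<Sum>s\<in>UNIV. \<Sum>s'\<in>UNIV. \<integral>\<^sup>+x. \<integral>\<^sup>+g. transport w (fid, s) (g, s') x \<partial>count_space UNIV \<partial>\<mu>)"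
    by (simp add: nn_integral_sum meas)
  also have "\<dots> = (\<Sum>s\<in>UNIV. \<Sum>s'\<in>UNIV. \<integral>\<^sup>+x. \<integral>\<^sup>+g. transport w (g, s) (fid, s') x \<partial>count_space UNIV \<partial>\<mu>)"
    unfolding swap move by (intro sum.cong refl nn_integral_bij_count_space[OF bij])
  also have "\<dots> = (\<Sum>s'\<in>UNIV. \<Sum>s\<in>UNIV. \<integral>\<^sup>+x. \<integral>\<^sup>+g. transport w (g, s) (fid, s') x \<partial>count_space UNIV \<partial>\<mu>)"
    by (rule sum.swap)
  also have "\<dots> = (\<integral>\<^sup>+x. (\<Sum>s'\<in>UNIV. \<Sum>s\<in>UNIV. \<integral>\<^sup>+g. transport w (g, s) (fid, s') x \<partial>count_space UNIV) \<partial>\<mu>)"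
    by (simp add: nn_integral_sum meas)
  finally show ?thesis .
qed

text \<open>The weights at one vertex cancel, so the mass leaving the identity is constant; the mass
  arriving is that constant plus the block averages. Mass transport gives these averages total mean
  zero, and they are nonnegative by assumption.\<close>

lemma block_weight_AE_zero:
  fixes y :: "'v \<Rightarrow> 'b letter \<Rightarrow> real"
  assumes fin: "AE x in \<mu>. \<forall>h. finite (block A x h)"
    and y_sum: "\<And>v. (\<Sum>s\<in>UNIV. y v s) = 0" and y_bound: "\<And>v s. \<bar>y v s\<bar> \<le> c"
    and nonneg: "AE x in \<mu>. \<forall>s. 0 \<le> (\<Sum>h\<in>block A x (fid, s). y (x (fst h)) (snd h))"
  shows "AE x in \<mu>. \<forall>s. (\<Sum>h\<in>block A x (fid, s). y (x (fst h)) (snd h)) = 0"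
proof -
  \<comment> \<open>Mass must be nonnegative, hence the offset \<open>c\<close>; it contributes
    \<open>n * c\<close> to both sides and cancels.\<close>
  define w where "w v s = y v s + c" for v s
  have w: "0 \<le> w v s" for v s using y_bound[of v s] by (simp add: w_def)
  have c: "0 \<le> c" using y_bound[of undefined undefined] by linarith
  define n where "n = real CARD('b letter)"
  define I where "I x = (\<Sum>s'\<in>UNIV. \<Sum>s\<in>UNIV. \<integral>\<^sup>+g. transport w (g, s) (fid, s') x \<partial>count_space UNIV)" for x
  define \<Phi> where "\<Phi> x s = (\<Sum>h\<in>block A x (fid, s). y (x (fst h)) (snd h))" for x and s :: "'b letter"
  have out: "(\<Sum>s\<in>UNIV. \<Sum>s'\<in>UNIV. \<integral>\<^sup>+g. transport w (fid, s) (g, s') x \<partial>count_space UNIV) = ennreal (n * c)"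
    if x: "\<forall>h. finite (block A x h)" for x
  proof -
    have "(\<Sum>s'\<in>UNIV. \<integral>\<^sup>+g. transport w (fid, s) (g, s') x \<partial>count_space UNIV) = ennreal (w (x fid) s)" for s
    proof -
      let ?B = "block A x (fid, s)"
      have "card ?B > 0" using x block_refl card_gt_0_iff by blast
      have "(\<Sum>s'\<in>UNIV. \<integral>\<^sup>+g. transport w (fid, s) (g, s') x \<partial>count_space UNIV)
          = (\<Sum>h\<in>?B. transport w (fid, s) h x)"
        by (rule sum_nn_integral_half_edges[OF x[rule_format]]) (simp add: transport_def)
      also have "\<dots> = (\<Sum>h\<in>?B. ennreal (w (x fid) s / card ?B))"
        by (intro sum.cong) (auto simp: transport_def)
      also have "\<dots> = ennreal (\<Sum>h\<in>?B. w (x fid) s / card ?B)"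
        by (rule sum_ennreal) (use w in simp)
      also have "\<dots> = ennreal (w (x fid) s)" using \<open>card ?B > 0\<close> by simp
      finally show ?thesis .
    qed
    then have "(\<Sum>s\<in>UNIV. \<Sum>s'\<in>UNIV. \<integral>\<^sup>+g. transport w (fid, s) (g, s') x \<partial>count_space UNIV)
        = ennreal (\<Sum>s\<in>UNIV. w (x fid) s)"
      using w by simp
    then show ?thesis by (simp add: w_def sum.distrib y_sum n_def)
  qed
  have inn: "I x = ennreal (n * c + (\<Sum>s\<in>UNIV. \<Phi> x s / card (block A x (fid, s))))"
    if x: "\<forall>h. finite (block A x h)" for x
  proof -
    have "(\<Sum>s\<in>UNIV. \<integral>\<^sup>+g. transport w (g, s) (fid, s') x \<partial>count_space UNIV)
        = ennreal (c + \<Phi> x s' / card (block A x (fid, s')))"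
      and "0 \<le> c + \<Phi> x s' / card (block A x (fid, s'))" for s'
    proof -
      let ?B = "block A x (fid, s')"
      have "card ?B > 0" using x block_refl card_gt_0_iff by blast
      then have eq: "(\<Sum>h\<in>?B. w (x (fst h)) (snd h) / card ?B) = c + \<Phi> x s' / card ?B"
        by (simp add: w_def \<Phi>_def sum.distrib add_divide_distrib flip: sum_divide_distrib)
      show "0 \<le> c + \<Phi> x s' / card ?B"
        unfolding eq[symmetric] using w by (intro sum_nonneg) simp
      have "(\<Sum>s\<in>UNIV. \<integral>\<^sup>+g. transport w (g, s) (fid, s') x \<partial>count_space UNIV)
          = (\<Sum>h\<in>?B. transport w h (fid, s') x)"
      proof (rule sum_nn_integral_half_edges[OF x[rule_format]])
        fix h assume "h \<notin> ?B"
        then show "transport w h (fid, s') x = 0"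
          using block_commute[of h A x "(fid, s')"] by (simp add: transport_def)
      qed
      also have "\<dots> = (\<Sum>h\<in>?B. ennreal (w (x (fst h)) (snd h) / card ?B))"
      proof (intro sum.cong refl)
        fix h assume h: "h \<in> ?B"
        then have "(fid, s') \<in> block A x h" using block_commute by blast
        then show "transport w h (fid, s') x = ennreal (w (x (fst h)) (snd h) / card ?B)"
          using block_eq[OF h] by (simp add: transport_def)
      qed
      also have "\<dots> = ennreal (\<Sum>h\<in>?B. w (x (fst h)) (snd h) / card ?B)"
        by (rule sum_ennreal) (use w in simp)
      finally show "(\<Sum>s\<in>UNIV. \<integral>\<^sup>+g. transport w (g, s) (fid, s') x \<partial>count_space UNIV)
        = ennreal (c + \<Phi> x s' / card ?B)" unfolding eq .
    qed
    then have "I x = ennreal (\<Sum>s'\<in>UNIV. c + \<Phi> x s' / card (block A x (fid, s')))"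
      unfolding I_def by simp
    then show ?thesis by (simp add: sum.distrib n_def)
  qed
  have I_meas [measurable]: "I \<in> borel_measurable \<mu>"
    unfolding I_def
    by (intro borel_measurable_sum borel_measurable_nn_integral_count_space) simp_all
  have "(\<integral>\<^sup>+x. I x \<partial>\<mu>) = (\<integral>\<^sup>+x. ennreal (n * c) \<partial>\<mu>)"
    unfolding I_def mass_transport[symmetric]
    by (rule nn_integral_cong_AE) (use fin out in auto)
  then have int_I: "(\<integral>\<^sup>+x. I x \<partial>\<mu>) = ennreal (n * c)"
    by (simp add: emeasure_space_1)
  \<comment> \<open>This domination makes the truncated subtraction of extended reals below
    exact.\<close>
  have "AE x in \<mu>. ennreal (n * c) \<le> I x"
    using fin nonneg
  proof eventually_elim
    case (elim x)
    have "0 \<le> (\<Sum>s\<in>UNIV. \<Phi> x s / card (block A x (fid, s)))"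
      unfolding \<Phi>_def by (intro sum_nonneg divide_nonneg_nonneg elim(2)[rule_format]) simp
    then show ?case unfolding inn[OF elim(1)] by (intro ennreal_leI) simp
  qed
  then have "(\<integral>\<^sup>+x. I x - ennreal (n * c) \<partial>\<mu>) = (\<integral>\<^sup>+x. I x \<partial>\<mu>) - (\<integral>\<^sup>+x. ennreal (n * c) \<partial>\<mu>)"
    by (intro nn_integral_diff) (simp_all add: emeasure_space_1)
  then have "(\<integral>\<^sup>+x. I x - ennreal (n * c) \<partial>\<mu>) = 0"
    by (simp add: int_I emeasure_space_1)
  then have "AE x in \<mu>. I x - ennreal (n * c) = 0"
    by (subst (asm) nn_integral_0_iff_AE) simp_all
  with fin nonneg show ?thesis
  proof eventually_elim
    case (elim x)
    have pos: "0 \<le> \<Phi> x s / card (block A x (fid, s))" for s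
      unfolding \<Phi>_def by (intro divide_nonneg_nonneg elim(2)[rule_format]) simp
    have "ennreal (n * c + (\<Sum>s\<in>UNIV. \<Phi> x s / card (block A x (fid, s))) - n * c) = 0"
      using elim(3) c unfolding inn[OF elim(1)] by (subst ennreal_minus[symmetric]) (simp_all add: n_def)
    then have "(\<Sum>s\<in>UNIV. \<Phi> x s / card (block A x (fid, s))) = 0"
      by (intro antisym sum_nonneg pos) (simp add: ennreal_eq_0_iff)
    then have "\<Phi> x s / card (block A x (fid, s)) = 0" for s
      using sum_nonneg_eq_0_iff[of UNIV "\<lambda>s. \<Phi> x s / card (block A x (fid, s))", OF finite pos]
      by blast
    moreover have "card (block A x (fid, s)) \<noteq> 0" for s
      using elim(1) block_refl by (metis card_eq_0_iff empty_iff)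
    ultimately show ?case by (simp add: \<Phi>_def)
  qed
qed

text \<open>Almost every point lies in the support of \<open>\<mu>\<close>: lists of pairs form a
  countable type indexing the cylinders, so the null cylinders have a null union.\<close>

lemma AE_cylinders_not_null:
  "AE x in \<mu>. \<forall>F. finite F \<longrightarrow> 0 < emeasure \<mu> {x' \<in> space \<mu>. \<forall>f\<in>F. x' f = x f}"
proof -
  define cyl where "cyl l = {x \<in> space \<mu>. \<forall>p\<in>set l. x (fst p) = snd p}" for l :: "('b fgrp \<times> 'v) list"
  have cyl_sets: "cyl l \<in> sets \<mu>" for l
    unfolding cyl_def by simp
  have "AE x in \<mu>. x \<in> cyl l \<longrightarrow> 0 < emeasure \<mu> (cyl l)" for l
  proof (cases "emeasure \<mu> (cyl l) = 0")
    case True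
    then have "AE x in \<mu>. x \<notin> cyl l"
      using cyl_sets by (intro AE_not_in) auto
    then show ?thesis by (rule AE_mp) simp
  qed (simp add: zero_less_iff_neq_zero)
  then have "AE x in \<mu>. \<forall>l. x \<in> cyl l \<longrightarrow> 0 < emeasure \<mu> (cyl l)"
    by (subst AE_all_countable) blast
  then show ?thesis
    using AE_space
  proof eventually_elim
    case (elim x)
    show ?case
    proof (intro allI impI)
      fix F :: "'b fgrp set" assume "finite F"
      then obtain fs where fs: "set fs = F" using finite_list by blast
      have "cyl (map (\<lambda>f. (f, x f)) fs) = {x' \<in> space \<mu>. \<forall>f\<in>F. x' f = x f}"
        using fs by (auto simp: cyl_def)
      moreover have "x \<in> cyl (map (\<lambda>f. (f, x f)) fs)"
        using elim(2) by (auto simp: cyl_def)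
      ultimately show "0 < emeasure \<mu> {x' \<in> space \<mu>. \<forall>f\<in>F. x' f = x f}"
        using elim(1) by metis
    qed
  qed
qed

text \<open>Replaces an exceptional set depending on \<open>y\<close> by conditions on
  \<open>x\<close> alone. The cylinder of \<open>x\<close> over its block has positive measure,
  hence contains a point where the sum vanishes; that point has the same block with the same
  colours.\<close>

lemma block_weight_zero:
  fixes y :: "'v \<Rightarrow> 'b letter \<Rightarrow> real"
  assumes fin: "AE x in \<mu>. \<forall>h. finite (block A x h)"
    and y_sum: "\<And>v. (\<Sum>s\<in>UNIV. y v s) = 0" and y_bound: "\<And>v s. \<bar>y v s\<bar> \<le> c"
    and nonneg: "AE x in \<mu>. \<forall>s. 0 \<le> (\<Sum>h\<in>block A x (fid, s). y (x (fst h)) (snd h))"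
    and x: "\<And>h. finite (block A x h)"
      "\<And>F. finite F \<Longrightarrow> 0 < emeasure \<mu> {x' \<in> space \<mu>. \<forall>f\<in>F. x' f = x f}"
  shows "(\<Sum>h\<in>block A x (fid, s). y (x (fst h)) (snd h)) = 0"
proof -
  define Z where "Z = {x' \<in> space \<mu>. \<forall>f\<in>fst ` block A x (fid, s). x' f = x f}"
  have "\<exists>x'\<in>Z. (\<Sum>h\<in>block A x' (fid, s). y (x' (fst h)) (snd h)) = 0"
  proof (rule ccontr)
    assume neg: "\<not> ?thesis"
    have "AE x' in \<mu>. x' \<notin> Z"
      using block_weight_AE_zero[OF fin y_sum y_bound nonneg] by eventually_elim (use neg in blast)
    moreover have "Z \<in> sets \<mu>"
      unfolding Z_def using x(1) by simp
    ultimately have "emeasure \<mu> Z = 0"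
      using AE_iff_measurable[of Z \<mu> "\<lambda>x'. x' \<notin> Z"] by (auto simp: Z_def)
    then show False using x(2)[of "fst ` block A x (fid, s)"] x(1) by (simp add: Z_def)
  qed
  then obtain x' where x': "x' \<in> Z" "(\<Sum>h\<in>block A x' (fid, s). y (x' (fst h)) (snd h)) = 0"
    by blast
  have "block A x' (fid, s) = block A x (fid, s)"
    by (rule block_cong) (use x' in \<open>auto simp: Z_def\<close>)
  moreover have "(\<Sum>h\<in>block A x (fid, s). y (x' (fst h)) (snd h))
      = (\<Sum>h\<in>block A x (fid, s). y (x (fst h)) (snd h))"
    by (rule sum.cong) (use x' in \<open>auto simp: Z_def\<close>)
  ultimately show ?thesis using x' by simp
qed

end

section \<open>Existence of periodic points\<close>

lemma sum_by_fibres: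
  fixes \<phi> :: "'c \<Rightarrow> real"
  assumes "finite B" "finite K" "\<And>c. c \<notin> K \<Longrightarrow> \<phi> c = 0"
  shows "(\<Sum>h\<in>B. \<phi> (p h)) = (\<Sum>c\<in>K. \<phi> c * card {h \<in> B. p h = c})"
proof -
  have "(\<Sum>c\<in>K. \<phi> c * card {h \<in> B. p h = c}) = (\<Sum>c\<in>K. \<Sum>h\<in>B. if p h = c then \<phi> c else 0)"
    using assms(1) by (intro sum.cong refl) (simp add: sum.If_cases Int_def mult.commute)
  also have "\<dots> = (\<Sum>h\<in>B. \<Sum>c\<in>K. if p h = c then \<phi> c else 0)"
    by (rule sum.swap)
  also have "\<dots> = (\<Sum>h\<in>B. \<phi> (p h))"
    using assms(2,3) by (intro sum.cong refl) (auto simp: sum.delta')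
  finally show ?thesis by simp
qed

text \<open>The transpose of \<open>excess\<close>: the reference label absorbs the negative row
  sum, so that the weights at each vertex cancel.\<close>

definition balanced_weight ::
    "'v set \<Rightarrow> 'b letter \<Rightarrow> ('v \<times> 'b letter \<Rightarrow> real) \<Rightarrow> 'v \<Rightarrow> 'b::finite letter \<Rightarrow> real" where
  "balanced_weight A s0 y v s =
    (if v \<in> A then y (v, s) - (if s = s0 then \<Sum>t\<in>UNIV. y (v, t) else 0) else 0)"

lemma sum_balanced_weight: "(\<Sum>s\<in>UNIV. balanced_weight A s0 y v s) = 0"
  by (cases "v \<in> A") (simp_all add: balanced_weight_def sum_subtractf)

lemma balanced_weight_bounded:
  assumes "finite A"
  shows "\<bar>balanced_weight A s0 y v s\<bar> \<le> (\<Sum>c\<in>A \<times> UNIV. \<bar>balanced_weight A s0 y (fst c) (snd c)\<bar>)"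
proof (cases "v \<in> A")
  case True
  then show ?thesis
    using member_le_sum[of "(v, s)" "A \<times> UNIV" "\<lambda>c. \<bar>balanced_weight A s0 y (fst c) (snd c)\<bar>"] assms
    by simp
next
  case False
  then show ?thesis by (simp add: balanced_weight_def sum_nonneg)
qed

text \<open>Mass transport needs each half-edge to carry its own weight; this turns a functional of
  the count vector into such a sum.\<close>

lemma sum_excess_eq_balanced_weight:
  fixes H :: "('b::finite fgrp \<times> 'b letter) set" and y :: "'v \<times> 'b letter \<Rightarrow> real"
  assumes "finite A" "finite H"
  shows "(\<Sum>c\<in>A \<times> UNIV. y c * excess s0 x H c)
      = (\<Sum>h\<in>H. balanced_weight A s0 y (x (fst h)) (snd h))"
proof -
  let ?n = "\<lambda>a t. real (colour_count x H a t)"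
  have row: "(\<Sum>t\<in>UNIV. balanced_weight A s0 y a t * ?n a t)
      = (\<Sum>t\<in>UNIV. y (a, t) * (?n a t - ?n a s0))" if "a \<in> A" for a
  proof -
    have "(\<Sum>t\<in>UNIV. balanced_weight A s0 y a t * ?n a t)
        = (\<Sum>t\<in>UNIV. y (a, t) * ?n a t - (if t = s0 then (\<Sum>t\<in>UNIV. y (a, t)) * ?n a s0 else 0))"
      using that by (intro sum.cong refl) (simp add: balanced_weight_def algebra_simps)
    also have "\<dots> = (\<Sum>t\<in>UNIV. y (a, t) * ?n a t) - (\<Sum>t\<in>UNIV. y (a, t)) * ?n a s0"
      by (simp add: sum_subtractf)
    also have "\<dots> = (\<Sum>t\<in>UNIV. y (a, t) * (?n a t - ?n a s0))"
      by (simp add: right_diff_distrib sum_subtractf sum_distrib_right)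
    finally show ?thesis .
  qed
  have "(\<Sum>h\<in>H. balanced_weight A s0 y (x (fst h)) (snd h))
      = (\<Sum>h\<in>H. (\<lambda>c. balanced_weight A s0 y (fst c) (snd c)) (x (fst h), snd h))" by simp
  also have "\<dots> = (\<Sum>c\<in>A \<times> UNIV. balanced_weight A s0 y (fst c) (snd c)
      * card {h \<in> H. (x (fst h), snd h) = c})"
    by (rule sum_by_fibres) (use assms in \<open>auto simp: balanced_weight_def\<close>)
  also have "\<dots> = (\<Sum>c\<in>A \<times> UNIV. balanced_weight A s0 y (fst c) (snd c) * ?n (fst c) (snd c))"
    by (intro sum.cong refl) (simp add: colour_count_def prod_eq_iff)
  also have "\<dots> = (\<Sum>a\<in>A. \<Sum>t\<in>UNIV. balanced_weight A s0 y a t * ?n a t)"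
    by (simp add: sum.cartesian_product case_prod_beta)
  also have "\<dots> = (\<Sum>a\<in>A. \<Sum>t\<in>UNIV. y (a, t) * (?n a t - ?n a s0))"
    by (intro sum.cong refl row)
  also have "\<dots> = (\<Sum>c\<in>A \<times> UNIV. y c * excess s0 x H c)"
    by (simp add: sum.cartesian_product case_prod_beta excess_def)
  finally show ?thesis by simp
qed

text \<open>The almost sure form serves both claims of the theorem: a set of full measure is
  nonempty, and it meets every event of positive measure, such as a prescribed colour at the
  identity.\<close>

lemma (in invariant_subshift_measure) AE_periodic_point:
  assumes "finite A" and fin: "AE x in \<mu>. \<forall>h. finite (block A x h)"
  shows "AE x in \<mu>. \<exists>z\<in>XG E. periodic z \<and> z fid = x fid"
proof -
  \<comment> \<open>Fixed before any functional \<open>y\<close> is chosen, so that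
    \<open>block_weight_zero\<close> holds at all these points for every \<open>y\<close>.\<close>
  define X0 where "X0 = {x \<in> XG E. (\<forall>h. finite (block A x h)) \<and>
      (\<forall>F. finite F \<longrightarrow> 0 < emeasure \<mu> {x' \<in> space \<mu>. \<forall>f\<in>F. x' f = x f})}"
  have X0: "x \<in> XG E" "finite (block A x h)"
    "finite F \<Longrightarrow> 0 < emeasure \<mu> {x' \<in> space \<mu>. \<forall>f\<in>F. x' f = x f}" if "x \<in> X0" for x h F
    using that unfolding X0_def by blast+
  have AE_X0: "AE x in \<mu>. x \<in> X0"
    using fin AE_cylinders_not_null AE_space
    by eventually_elim (auto simp: X0_def space_\<mu>)
  have "\<exists>z\<in>XG E. periodic z \<and> z fid = x fid" if x: "x \<in> X0" for x
  proof -
    fix s0 :: "'b letter"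
    define u where "u = (\<lambda>(x, s). excess s0 x (block A x (fid, s)))"
    \<comment> \<open>Repetition in the list \<open>l\<close> encodes multiplicities of
      blocks.\<close>
    define M where "M = {\<lambda>c. \<Sum>p\<leftarrow>l. u p c | l. set l \<subseteq> X0 \<times> UNIV}"
    have "\<exists>v\<in>M. \<forall>c\<in>A \<times> UNIV. u (x, s0) c + v c = 0"
    proof (rule stiemke_integer_vectors[where G = "u ` (X0 \<times> UNIV)"])
      show "(\<lambda>c. v c + w c) \<in> M" if vw: "v \<in> M" "w \<in> M" for v w
      proof -
        obtain l l' where "v = (\<lambda>c. \<Sum>p\<leftarrow>l. u p c)" "w = (\<lambda>c. \<Sum>p\<leftarrow>l'. u p c)"
          "set l \<subseteq> X0 \<times> UNIV" "set l' \<subseteq> X0 \<times> UNIV"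
          using vw by (auto simp: M_def)
        then show ?thesis
          unfolding M_def by (intro CollectI exI[of _ "l @ l'"]) simp
      qed
      show "(\<lambda>_. 0) \<in> M"
        unfolding M_def by (intro CollectI exI[of _ "[]"]) simp
      show "u ` (X0 \<times> UNIV) \<subseteq> M"
      proof
        fix v assume "v \<in> u ` (X0 \<times> UNIV)"
        then obtain p where "p \<in> X0 \<times> UNIV" "v = u p" by blast
        then show "v \<in> M"
          unfolding M_def by (intro CollectI exI[of _ "[p]"]) simp
      qed
      show "u (x, s0) \<in> u ` (X0 \<times> UNIV)" using x by blast
    next
      fix y :: "'v \<times> 'b letter \<Rightarrow> real"
      have eq: "(\<Sum>c\<in>A \<times> UNIV. y c * u (x, s) c)
          = (\<Sum>h\<in>block A x (fid, s). balanced_weight A s0 y (x (fst h)) (snd h))"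
        if "x \<in> X0" for x s
        unfolding u_def prod.case
        by (rule sum_excess_eq_balanced_weight) (use \<open>finite A\<close> X0(2)[OF that] in simp_all)
      assume nonneg: "\<forall>v\<in>u ` (X0 \<times> UNIV). 0 \<le> (\<Sum>c\<in>A \<times> UNIV. y c * v c)"
      have pos: "AE x in \<mu>. \<forall>s. 0 \<le> (\<Sum>h\<in>block A x (fid, s). balanced_weight A s0 y (x (fst h)) (snd h))"
        using AE_X0
      proof eventually_elim
        case (elim x)
        show ?case
        proof
          fix s
          have "u (x, s) \<in> u ` (X0 \<times> UNIV)" using elim by blast
          from nonneg[rule_format, OF this]
          show "0 \<le> (\<Sum>h\<in>block A x (fid, s). balanced_weight A s0 y (x (fst h)) (snd h))"
            unfolding eq[OF elim] .
        qed
      qed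
      have "(\<Sum>c\<in>A \<times> UNIV. y c * u (x, s) c) = 0" if "x \<in> X0" for x s
        unfolding eq[OF that]
        by (rule block_weight_zero[OF fin sum_balanced_weight balanced_weight_bounded[OF \<open>finite A\<close>] pos])
          (use X0[OF that] in simp_all)
      then show "\<forall>v\<in>u ` (X0 \<times> UNIV). (\<Sum>c\<in>A \<times> UNIV. y c * v c) = 0" by blast
    qed (use \<open>finite A\<close> in simp)
    then obtain l where l: "set l \<subseteq> X0 \<times> UNIV"
        "\<And>c. c \<in> A \<times> UNIV \<Longrightarrow> u (x, s0) c + (\<Sum>p\<leftarrow>l. u p c) = 0"
      unfolding M_def by blast
    \<comment> \<open>Putting \<open>(x, s0)\<close> in front keeps a half-edge at the identity of
      \<open>x\<close> in the family, so that its colour can become the root colour.\<close>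
    show ?thesis
    proof (rule periodic_from_balanced_blocks[where l = "(x, s0) # l" and ?s0.0 = s0 and ?t0.0 = s0])
      show "x' \<in> XG E \<and> finite (block A x' (fid, s))" if "(x', s) \<in> set ((x, s0) # l)" for x' s
      proof -
        have "x' \<in> X0" using that l(1) x by auto
        then show ?thesis using X0(1,2) by blast
      qed
      show "(\<Sum>(x, s)\<leftarrow>(x, s0) # l. excess s0 x (block A x (fid, s)) (a, t)) = 0"
        if "a \<in> A" for a t
        using l(2)[of "(a, t)"] that by (simp add: u_def case_prod_unfold)
    qed simp
  qed
  then show ?thesis using AE_X0 by (auto elim: AE_mp)
qed

theorem theorem6:
  fixes E :: "('v::countable \<times> 'v \<times> ('b::finite) letter) set"
    and A :: "'v set"
    and \<mu> :: "('b fgrp \<Rightarrow> 'v) measure"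
  assumes "finite A"
    and "sets \<mu> = sets (restrict_space config_space (XG E))"
    and "space \<mu> = XG E"
    and "prob_space \<mu>"
    and "\<forall>g. \<forall>B\<in>sets \<mu>. emeasure \<mu> (shift g -` B \<inter> space \<mu>) = emeasure \<mu> B"
    and "AE x in \<mu>. \<forall>C. S_component (x -` (UNIV - A)) C \<longrightarrow> finite C"
  shows "(\<exists>x\<in>XG E. periodic x) \<and>
         (\<forall>a1\<in>A. emeasure \<mu> {x\<in>space \<mu>. x fid = a1} > 0 \<longrightarrow>
              (\<exists>x\<in>XG E. periodic x \<and> x fid = a1))"
proof -
  interpret invariant_subshift_measure \<mu> E A
    using assms by unfold_locales (auto simp: prob_space_def finite_measure_def
        sigma_finite_measure_def finite_measure_axioms_def prob_space_axioms_def)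
  have fin: "AE x in \<mu>. \<forall>h. finite (block A x h)"
    using assms(6) by eventually_elim (blast intro: finite_block)
  note AE = AE_periodic_point[OF \<open>finite A\<close> fin]
  have "\<exists>x\<in>XG E. periodic x"
  proof (rule ccontr)
    assume "\<not> ?thesis"
    then have "AE x in \<mu>. False" using AE by (auto elim: AE_mp)
    then show False by simp
  qed
  moreover have "\<exists>x\<in>XG E. periodic x \<and> x fid = a1"
    if "emeasure \<mu> {x\<in>space \<mu>. x fid = a1} > 0" for a1
  proof (rule ccontr)
    assume neg: "\<not> ?thesis"
    have "AE x in \<mu>. x fid \<noteq> a1" using AE by (rule AE_mp) (use neg in auto)
    then have "emeasure \<mu> {x\<in>space \<mu>. x fid = a1} = 0"
      by (subst (asm) AE_iff_measurable[OF _ refl]) simp_all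
    then show False using that by simp
  qed
  ultimately show ?thesis by blast
qed

end
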